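(* Let $a$ be a non-zero real constant and let $M=\mathbb{R}^4$ be equipped with the Gödel metric $g$ given in the coordinates $(x^1,x^2,x^3,x^4)$ by $$ds^2=a^2\left(-(dx^1)^2+\tfrac12 e^{2x^1}(dx^2)^2-(dx^3)^2+(dx^4)^2+2e^{x^1}dx^2\,dx^4\right).$$ Let $R$, $S$, $\kappa$, $C$ and $conh(R)$ be the Riemann-Christoffel curvature tensor, Ricci tensor, scalar curvature, Weyl conformal curvature tensor and conharmonic curvature tensor of $(M,g)$, and let $\omega$ be the $1$-form $\omega=a e^{x^1}dx^2+a\,dx^4$. Then: (1) the Ricci tensor of $(M,g)$ is cyclic parallel, i.e. $(\nabla_XS)(Y,Z)+(\nabla_YS)(Z,X)+(\nabla_ZS)(X,Y)=0$ for all vector fields $X,Y,Z$; (2) $(M,g)$ is Riemann compatible; (3) $\operatorname{rank} S=1$ at every point; (4) $R\cdot R=Q(S,R)$; (5) $conh(R)\cdot C=conh(R)\cdot conh(R)=0$; (6) $C\cdot C=C\cdot conh(R)=\frac{\kappa}{6}\,Q(g,C)$; (7) the $1$-form $\omega$ is $R$-compatible as well as Weyl compatible.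
   Context: Let $(M,g)$ be a semi-Riemannian manifold (metric of arbitrary signature) of dimension $n$, here $n=4$, with Levi-Civita connection $\nabla$. Curvature conventions: $\mathcal{R}(X,Y)Z=\nabla_X\nabla_YZ-\nabla_Y\nabla_XZ-\nabla_{[X,Y]}Z$, $R(X_1,X_2,X_3,X_4)=g(\mathcal{R}(X_1,X_2)X_3,X_4)$, $S(Y,Z)=\operatorname{tr}\{X\mapsto\mathcal{R}(X,Y)Z\}$, the Ricci operator $\mathcal{L}$ is defined by $g(X,\mathcal{L}Y)=S(X,Y)$, and $\kappa=\operatorname{tr}\mathcal{L}$ (for the Gödel metric this gives $\kappa=1/a^2$). For a symmetric $(0,2)$-tensor $A$ put $(X\wedge_AY)Z=A(Y,Z)X-A(X,Z)Y$. Define the endomorphisms $$\mathcal{C}(X,Y)=\mathcal{R}(X,Y)-\tfrac{1}{n-2}\left(X\wedge_g\mathcal{L}Y+\mathcal{L}X\wedge_gY-\tfrac{\kappa}{n-1}X\wedge_gY\right),$$ $$conh(\mathcal{R})(X,Y)=\mathcal{R}(X,Y)-\tfrac{1}{n-2}\left(X\wedge_g\mathcal{L}Y+\mathcal{L}X\wedge_gY\right).$$ The Weyl conformal curvature tensor is $C(X_1,X_2,X_3,X_4)=g(\mathcal{C}(X_1,X_2)X_3,X_4)$ and the conharmonic curvature tensor is $conh(R)(X_1,X_2,X_3,X_4)=g(conh(\mathcal{R})(X_1,X_2)X_3,X_4)$. For an endomorphism-valued $\mathcal{D}(X,Y)$ and a $(0,k)$-tensor $T$, set $$(\mathcal{D}(X,Y)\cdot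 T)(X_1,\dots,X_k)=-T(\mathcal{D}(X,Y)X_1,X_2,\dots,X_k)-\cdots-T(X_1,\dots,X_{k-1},\mathcal{D}(X,Y)X_k).$$ Then the $(0,k+2)$-tensors $R\cdot T$, $C\cdot T$, $conh(R)\cdot T$ and $Q(A,T)$ are defined by taking $(\,\cdot\,)(X_1,\dots,X_k;X,Y)=(\mathcal{D}(X,Y)\cdot T)(X_1,\dots,X_k)$ with $\mathcal{D}(X,Y)$ equal to $\mathcal{R}(X,Y)$, $\mathcal{C}(X,Y)$, $conh(\mathcal{R})(X,Y)$ and $X\wedge_AY$, respectively. $(M,g)$ is called Riemann compatible if $R(\mathcal{L}X,Y,Z,W)+R(\mathcal{L}Z,Y,W,X)+R(\mathcal{L}W,Y,X,Z)=0$ for all vector fields $X,Y,Z,W$. A $1$-form $\omega$ is called $R$-compatible if, in local components, $\omega_r g^{rs}(\omega_hR_{sijk}+\omega_jR_{sikh}+\omega_kR_{sihj})=0$ for all indices $h,i,j,k$ (summation over $r,s$). It is called Weyl compatible if the same identity holds with $R$ replaced by $C$. *)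

theory Defs
  imports "HOL-Analysis.Analysis"
begin

text \<open>
  Semi-Riemannian geometry on \<open>\<real>^n\<close> with its global coordinate chart. A metric \<open>g\<close> assigns to each
  point \<open>p\<close> a bilinear form \<open>g p\<close>; vector fields are maps \<open>real^'n \<Rightarrow> real^'n\<close> giving the components
  in the coordinate frame \<open>axis i 1\<close>; a \<open>(0,k)\<close>-tensor field is a \<open>k\<close>-ary multilinear function at each
  point.
\<close>

type_synonym 'n vfield = "real^'n \<Rightarrow> real^'n"
type_synonym 'n form2 = "real^'n \<Rightarrow> real^'n \<Rightarrow> real"
type_synonym 'n form4 = "real^'n \<Rightarrow> real^'n \<Rightarrow> real^'n \<Rightarrow> real^'n \<Rightarrow> real"
type_synonym 'n endo2 = "real^'n \<Rightarrow> real^'n \<Rightarrow> real^'n \<Rightarrow> real^'n"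

primrec Ck :: "nat \<Rightarrow> (real^'n \<Rightarrow> 'b::real_normed_vector) \<Rightarrow> bool" where
  "Ck 0 f \<longleftrightarrow> continuous_on UNIV f"
| "Ck (Suc k) f \<longleftrightarrow> f differentiable_on UNIV \<and>
     (\<forall>i. Ck k (\<lambda>p. frechet_derivative f (at p) (axis i 1)))"

definition smooth :: "(real^'n \<Rightarrow> 'b::real_normed_vector) \<Rightarrow> bool" where
  "smooth f \<longleftrightarrow> (\<forall>k. Ck k f)"

definition gram :: "(real^'n \<Rightarrow> 'n form2) \<Rightarrow> real^'n \<Rightarrow> real^'n^'n" where
  "gram g p = (\<chi> i j. g p (axis i 1) (axis j 1))"

text \<open>\<open>christoffel g p k i j\<close> is \<open>\<Gamma>\<close> with upper index \<open>k\<close> and lower indices \<open>i, j\<close>.\<close>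

definition christoffel :: "(real^'n \<Rightarrow> 'n form2) \<Rightarrow> real^'n \<Rightarrow> 'n \<Rightarrow> 'n \<Rightarrow> 'n \<Rightarrow> real" where
  "christoffel g p k i j = 1/2 * (\<Sum>l\<in>UNIV. matrix_inv (gram g p) $ k $ l *
     (frechet_derivative (\<lambda>q. gram g q $ j $ l) (at p) (axis i 1)
    + frechet_derivative (\<lambda>q. gram g q $ i $ l) (at p) (axis j 1)
    - frechet_derivative (\<lambda>q. gram g q $ i $ j) (at p) (axis l 1)))"

text \<open>
  The Levi-Civita connection; the lemmas \<open>nabla_torsion_free\<close> and \<open>nabla_metric\<close> below state its two
  characteristic properties.
\<close>

definition nabla :: "(real^'n \<Rightarrow> 'n form2) \<Rightarrow> 'n vfield \<Rightarrow> 'n vfield \<Rightarrow> 'n vfield" where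
  "nabla g X Y p = frechet_derivative Y (at p) (X p)
     + (\<chi> k. \<Sum>i\<in>UNIV. \<Sum>j\<in>UNIV. christoffel g p k i j * X p $ i * Y p $ j)"

definition lie_bracket :: "'n::finite vfield \<Rightarrow> 'n vfield \<Rightarrow> 'n vfield" where
  "lie_bracket X Y p = frechet_derivative Y (at p) (X p) - frechet_derivative X (at p) (Y p)"

definition curvature ::
  "(real^'n \<Rightarrow> 'n form2) \<Rightarrow> 'n vfield \<Rightarrow> 'n vfield \<Rightarrow> 'n vfield \<Rightarrow> 'n vfield" where
  "curvature g X Y Z p =
     nabla g X (nabla g Y Z) p - nabla g Y (nabla g X Z) p - nabla g (lie_bracket X Y) Z p"

text \<open>
  The value of the curvature operator on tangent vectors at \<open>p\<close>, computed on their constant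
  extensions; by lemma \<open>curvature_tensorial\<close> below, any smooth extensions give the same value
  (lemma \<open>godel_christoffel_differentiable\<close> supplies its regularity assumption).
\<close>

definition curv_op :: "(real^'n \<Rightarrow> 'n form2) \<Rightarrow> real^'n \<Rightarrow> 'n endo2" where
  "curv_op g p x y z = curvature g (\<lambda>_. x) (\<lambda>_. y) (\<lambda>_. z) p"

text \<open>The \<open>(0,4)\<close>-tensor \<open>g (D(X\<^sub>1, X\<^sub>2) X\<^sub>3, X\<^sub>4)\<close> of an endomorphism-valued \<open>D\<close>.\<close>

definition lower :: "(real^'n \<Rightarrow> 'n form2) \<Rightarrow> real^'n \<Rightarrow> 'n endo2 \<Rightarrow> 'n form4" where
  "lower g p D x1 x2 x3 x4 = g p (D x1 x2 x3) x4"

definition riem :: "(real^'n \<Rightarrow> 'n form2) \<Rightarrow> real^'n \<Rightarrow> 'n form4" where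
  "riem g p = lower g p (curv_op g p)"

definition ricci :: "(real^'n \<Rightarrow> 'n form2) \<Rightarrow> real^'n \<Rightarrow> 'n form2" where
  "ricci g p y z = trace (matrix (\<lambda>x. curv_op g p x y z))"

definition ricci_op :: "(real^'n \<Rightarrow> 'n form2) \<Rightarrow> real^'n \<Rightarrow> real^'n \<Rightarrow> real^'n" where
  "ricci_op g p y = (THE v. \<forall>x. g p x v = ricci g p x y)"

definition scalar_curv :: "(real^'n \<Rightarrow> 'n form2) \<Rightarrow> real^'n \<Rightarrow> real" where
  "scalar_curv g p = trace (matrix (ricci_op g p))"

definition wedge :: "'n::finite form2 \<Rightarrow> 'n endo2" where
  "wedge A x y z = A y z *\<^sub>R x - A x z *\<^sub>R y"

definition conh_op :: "(real^'n \<Rightarrow> 'n form2) \<Rightarrow> real^'n \<Rightarrow> 'n endo2" where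
  "conh_op g p x y z = curv_op g p x y z - (1 / (real CARD('n) - 2)) *\<^sub>R
     (wedge (g p) x (ricci_op g p y) z + wedge (g p) (ricci_op g p x) y z)"

definition weyl_op :: "(real^'n \<Rightarrow> 'n form2) \<Rightarrow> real^'n \<Rightarrow> 'n endo2" where
  "weyl_op g p x y z = curv_op g p x y z - (1 / (real CARD('n) - 2)) *\<^sub>R
     (wedge (g p) x (ricci_op g p y) z + wedge (g p) (ricci_op g p x) y z
      - (scalar_curv g p / (real CARD('n) - 1)) *\<^sub>R wedge (g p) x y z)"

definition conh :: "(real^'n \<Rightarrow> 'n form2) \<Rightarrow> real^'n \<Rightarrow> 'n form4" where
  "conh g p = lower g p (conh_op g p)"

definition weyl :: "(real^'n \<Rightarrow> 'n form2) \<Rightarrow> real^'n \<Rightarrow> 'n form4" where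
  "weyl g p = lower g p (weyl_op g p)"

text \<open>
  The \<open>(0,6)\<close>-tensors \<open>D \<cdot> T\<close> and \<open>Q(A, T)\<close> of a \<open>(0,4)\<close>-tensor \<open>T\<close>. The last two arguments are the
  vectors \<open>X, Y\<close> written after the semicolon in \<open>(X\<^sub>1, \<dots>, X\<^sub>4; X, Y)\<close>.
\<close>

definition act :: "'n::finite endo2 \<Rightarrow> 'n form4 \<Rightarrow>
    real^'n \<Rightarrow> real^'n \<Rightarrow> real^'n \<Rightarrow> real^'n \<Rightarrow> real^'n \<Rightarrow> real^'n \<Rightarrow> real" where
  "act D T x1 x2 x3 x4 x y =
     - T (D x y x1) x2 x3 x4 - T x1 (D x y x2) x3 x4
     - T x1 x2 (D x y x3) x4 - T x1 x2 x3 (D x y x4)"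

definition tachibana :: "'n::finite form2 \<Rightarrow> 'n form4 \<Rightarrow>
    real^'n \<Rightarrow> real^'n \<Rightarrow> real^'n \<Rightarrow> real^'n \<Rightarrow> real^'n \<Rightarrow> real^'n \<Rightarrow> real" where
  "tachibana A T = act (wedge A) T"

text \<open>\<open>nabla_form2 g A X Y Z\<close> is \<open>(\<nabla>\<^sub>X A)(Y, Z) = X (A(Y, Z)) - A(\<nabla>\<^sub>X Y, Z) - A(Y, \<nabla>\<^sub>X Z)\<close>.\<close>

definition nabla_form2 :: "(real^'n \<Rightarrow> 'n form2) \<Rightarrow> (real^'n \<Rightarrow> 'n form2) \<Rightarrow>
    'n vfield \<Rightarrow> 'n vfield \<Rightarrow> 'n vfield \<Rightarrow> real^'n \<Rightarrow> real" where
  "nabla_form2 g A X Y Z p =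
     frechet_derivative (\<lambda>q. A q (Y q) (Z q)) (at p) (X p)
     - A p (nabla g X Y p) (Z p) - A p (Y p) (nabla g X Z p)"

definition cyclic_parallel :: "(real^'n \<Rightarrow> 'n form2) \<Rightarrow> (real^'n \<Rightarrow> 'n form2) \<Rightarrow> bool" where
  "cyclic_parallel g A \<longleftrightarrow> (\<forall>X Y Z. smooth X \<longrightarrow> smooth Y \<longrightarrow> smooth Z \<longrightarrow>
     (\<forall>p. nabla_form2 g A X Y Z p + nabla_form2 g A Y Z X p + nabla_form2 g A Z X Y p = 0))"

text \<open>Tensor identities over all vector fields are stated pointwise, over all tangent vectors.\<close>

definition riemann_compatible :: "(real^'n \<Rightarrow> 'n form2) \<Rightarrow> bool" where
  "riemann_compatible g \<longleftrightarrow> (\<forall>p x y z w.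
     riem g p (ricci_op g p x) y z w + riem g p (ricci_op g p z) y w x
     + riem g p (ricci_op g p w) y x z = 0)"

definition form1_compatible ::
  "(real^'n \<Rightarrow> 'n form2) \<Rightarrow> (real^'n \<Rightarrow> 'n form4) \<Rightarrow> (real^'n \<Rightarrow> real^'n \<Rightarrow> real) \<Rightarrow> bool" where
  "form1_compatible g T \<omega> \<longleftrightarrow> (\<forall>p h i j k.
     let w = (\<lambda>r. \<omega> p (axis r 1));
         t = (\<lambda>s i j k. T p (axis s 1) (axis i 1) (axis j 1) (axis k 1))
     in (\<Sum>r\<in>UNIV. \<Sum>s\<in>UNIV. w r * matrix_inv (gram g p) $ r $ s *
          (w h * t s i j k + w j * t s i k h + w k * t s i h j)) = 0)"


abbreviation fd :: "(real^'n \<Rightarrow> 'b::real_normed_vector) \<Rightarrow> real^'n \<Rightarrow> real^'n \<Rightarrow> 'b" where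
  "fd f p v \<equiv> frechet_derivative f (at p) v"

lemma christoffel_sym:
  assumes "\<And>q x y. g q x y = g q y x"
  shows "christoffel g p k i j = christoffel g p k j i"
proof -
  have "gram g q $ i $ j = gram g q $ j $ i" for q i j
    by (simp add: gram_def assms)
  then show ?thesis
    unfolding christoffel_def by (simp add: algebra_simps)
qed

lemma nabla_torsion_free:
  assumes "\<And>q x y. g q x y = g q y x"
  shows "nabla g X Y p - nabla g Y X p = lie_bracket X Y p"
proof -
  have "(\<Sum>i\<in>UNIV. \<Sum>j\<in>UNIV. christoffel g p k i j * X p $ i * Y p $ j)
      = (\<Sum>i\<in>UNIV. \<Sum>j\<in>UNIV. christoffel g p k i j * Y p $ i * X p $ j)" for k
    by (subst sum.swap) (simp add: christoffel_sym[of g p k, OF assms] mult_ac)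
  then show ?thesis
    by (simp add: nabla_def lie_bracket_def vec_eq_iff)
qed

lemma form2_expand:
  fixes b :: "'n::finite form2"
  assumes "bilinear b"
  shows "b x y = (\<Sum>i\<in>UNIV. \<Sum>j\<in>UNIV. b (axis i 1) (axis j 1) * x $ i * y $ j)"
proof -
  have "b x y = b (\<Sum>i\<in>UNIV. x $ i *\<^sub>R axis i 1) (\<Sum>j\<in>UNIV. y $ j *\<^sub>R axis j 1)"
    by (simp add: basis_expansion flip: scalar_mult_eq_scaleR)
  also have "\<dots> = (\<Sum>i\<in>UNIV. \<Sum>j\<in>UNIV. b (x $ i *\<^sub>R axis i 1) (y $ j *\<^sub>R axis j 1))"
    by (subst bilinear_sum[OF assms]) (simp add: sum.cartesian_product)
  also have "\<dots> = (\<Sum>i\<in>UNIV. \<Sum>j\<in>UNIV. b (axis i 1) (axis j 1) * x $ i * y $ j)"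
    by (simp add: bilinear_lmul[OF assms] bilinear_rmul[OF assms] mult_ac)
  finally show ?thesis .
qed

lemma fd_expand:
  assumes "f differentiable at p"
  shows "fd f p v = (\<Sum>i\<in>UNIV. v $ i *\<^sub>R fd f p (axis i 1))"
proof -
  have l: "linear (frechet_derivative f (at p))"
    using assms by (rule linear_frechet_derivative)
  have "v = (\<Sum>i\<in>UNIV. v $ i *\<^sub>R axis i 1)"
    by (simp add: basis_expansion flip: scalar_mult_eq_scaleR)
  then have "fd f p v = fd f p (\<Sum>i\<in>UNIV. v $ i *\<^sub>R axis i 1)" by simp
  also have "\<dots> = (\<Sum>i\<in>UNIV. v $ i *\<^sub>R fd f p (axis i 1))"
    by (simp add: linear_sum[OF l] linear_scale[OF l])
  finally show ?thesis .
qed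

lemma has_fd: "f differentiable at p \<Longrightarrow> (f has_derivative fd f p) (at p)"
  by (simp add: frechet_derivative_works)

lemma fd_eqI: "(f has_derivative D) (at p) \<Longrightarrow> fd f p v = D v"
  using frechet_derivative_at by metis

lemma has_derivative_nth:
  "(f has_derivative D) F \<Longrightarrow> ((\<lambda>x. f x $ k) has_derivative (\<lambda>v. D v $ k)) F"
  by (rule bounded_linear.has_derivative[OF bounded_linear_vec_nth])

lemma sum_rot3:
  "(\<Sum>k\<in>A. \<Sum>i\<in>B. \<Sum>l\<in>C. F k i l) = (\<Sum>i\<in>B. \<Sum>l\<in>C. \<Sum>k\<in>A. F k i l)"
  by (rule trans[OF sum.swap sum.cong[OF refl sum.swap]])

lemma nabla_metric:
  assumes bil: "\<And>q. bilinear (g q)" and sym: "\<And>q x y. g q x y = g q y x"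
    and nondeg: "invertible (gram g p)"
    and dg: "\<And>i j. (\<lambda>q. gram g q $ i $ j) differentiable at p"
    and dY: "Y differentiable at p" and dZ: "Z differentiable at p"
  shows "fd (\<lambda>q. g q (Y q) (Z q)) p (X p) = g p (nabla g X Y p) (Z p) + g p (Y p) (nabla g X Z p)"
proof -
  let ?G = "\<lambda>q i j. gram g q $ i $ j"
  have G: "?G q i j = g q (axis i 1) (axis j 1)" for q i j by (simp add: gram_def)
  have Gs: "?G q i j = ?G q j i" for q i j by (simp add: G sym)
  have e: "g q x y = (\<Sum>i\<in>UNIV. \<Sum>j\<in>UNIV. ?G q i j * x $ i * y $ j)" for q x y
    unfolding G by (rule form2_expand[OF bil])
  have low: "(\<Sum>k\<in>UNIV. ?G p k j * christoffel g p k i l)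
      = 1/2 * (fd (\<lambda>q. ?G q l j) p (axis i 1) + fd (\<lambda>q. ?G q i j) p (axis l 1)
          - fd (\<lambda>q. ?G q i l) p (axis j 1))" for i l j
  proof -
    let ?T = "\<lambda>m. 1/2 * (fd (\<lambda>q. ?G q l m) p (axis i 1) + fd (\<lambda>q. ?G q i m) p (axis l 1)
          - fd (\<lambda>q. ?G q i l) p (axis m 1))"
    have inv: "gram g p ** matrix_inv (gram g p) = mat 1"
      using nondeg unfolding invertible_def matrix_inv_def by (rule someI2_ex) simp
    have "(\<Sum>k\<in>UNIV. ?G p k j * christoffel g p k i l)
        = (\<Sum>k\<in>UNIV. \<Sum>m\<in>UNIV. ?G p j k * matrix_inv (gram g p) $ k $ m * ?T m)"
      by (simp add: christoffel_def Gs[of p _ j] sum_distrib_left mult_ac)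
    also have "\<dots> = (\<Sum>m\<in>UNIV. (gram g p ** matrix_inv (gram g p)) $ j $ m * ?T m)"
      by (subst sum.swap) (simp add: matrix_matrix_mult_def sum_distrib_right sum_divide_distrib)
    also have "\<dots> = ?T j"
    proof -
      have "(mat 1 :: real^'a^'a) $ j $ m * ?T m = (if j = m then ?T m else 0)" for m
        by (simp add: mat_def)
      then show ?thesis unfolding inv by (simp only: sum.delta' finite UNIV_I if_True)
    qed
    finally show ?thesis .
  qed
  have first: "g p (\<chi> k. \<Sum>i\<in>UNIV. \<Sum>l\<in>UNIV. christoffel g p k i l * x $ i * y $ l) z
     = (\<Sum>j\<in>UNIV. \<Sum>i\<in>UNIV. \<Sum>l\<in>UNIV. (\<Sum>k\<in>UNIV. ?G p k j * christoffel g p k i l) * x $ i * y $ l * z $ j)"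
    for x y z
  proof -
    have "g p (\<chi> k. \<Sum>i\<in>UNIV. \<Sum>l\<in>UNIV. christoffel g p k i l * x $ i * y $ l) z
      = (\<Sum>k\<in>UNIV. \<Sum>j\<in>UNIV. \<Sum>i\<in>UNIV. \<Sum>l\<in>UNIV. ?G p k j * christoffel g p k i l * x $ i * y $ l * z $ j)"
      by (simp add: e sum_distrib_left sum_distrib_right mult_ac)
    also have "\<dots> = (\<Sum>j\<in>UNIV. \<Sum>i\<in>UNIV. \<Sum>l\<in>UNIV. \<Sum>k\<in>UNIV. ?G p k j * christoffel g p k i l * x $ i * y $ l * z $ j)"
      by (rule trans[OF sum.swap sum.cong[OF refl sum_rot3]])
    finally show ?thesis by (simp add: sum_distrib_right)
  qed
  define D where "D i j l = fd (\<lambda>q. ?G q i j) p (axis l 1)" for i j l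
  have Ds: "D i j l = D j i l" for i j l
    unfolding D_def using Gs by simp
  have c: "g p (\<chi> k. \<Sum>i\<in>UNIV. \<Sum>l\<in>UNIV. christoffel g p k i l * x $ i * y $ l) z
     = 1/2 * (\<Sum>j\<in>UNIV. \<Sum>i\<in>UNIV. \<Sum>l\<in>UNIV. (D l j i + D i j l - D i l j) * x $ i * y $ l * z $ j)" for x y z
    unfolding first low D_def[symmetric] by (simp add: sum_distrib_left mult.assoc)
  have sw: "(\<Sum>j\<in>UNIV. \<Sum>i\<in>UNIV. \<Sum>l\<in>UNIV. (D l j i + D i j l - D i l j) * x $ i * z $ l * y $ j)
     = (\<Sum>j\<in>UNIV. \<Sum>i\<in>UNIV. \<Sum>l\<in>UNIV. (D j l i + D i l j - D i j l) * x $ i * y $ l * z $ j)" for x y z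
  proof -
    have "(\<Sum>j\<in>UNIV. \<Sum>i\<in>UNIV. \<Sum>l\<in>UNIV. F j i l) = (\<Sum>l\<in>UNIV. \<Sum>i\<in>UNIV. \<Sum>j\<in>UNIV. F j i l)"
      for F :: "'a \<Rightarrow> 'a \<Rightarrow> 'a \<Rightarrow> real"
      by (rule trans[OF sum_rot3 trans[OF sum.swap sum.cong[OF refl refl]]])
    from this[of "\<lambda>j i l. (D l j i + D i j l - D i l j) * x $ i * z $ l * y $ j"]
    show ?thesis by (simp add: mult_ac)
  qed
  have s: "g p (\<chi> k. \<Sum>i\<in>UNIV. \<Sum>l\<in>UNIV. christoffel g p k i l * x $ i * y $ l) z
     + g p y (\<chi> k. \<Sum>i\<in>UNIV. \<Sum>l\<in>UNIV. christoffel g p k i l * x $ i * z $ l)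
     = (\<Sum>j\<in>UNIV. \<Sum>i\<in>UNIV. \<Sum>l\<in>UNIV. D l j i * x $ i * y $ l * z $ j)" for x y z
  proof -
    have "D l j i = 1/2 * (D l j i + D i j l - D i l j) + 1/2 * (D j l i + D i l j - D i j l)" for l j i
      using Ds[of l j i] by (simp add: field_simps)
    then have "(\<Sum>j\<in>UNIV. \<Sum>i\<in>UNIV. \<Sum>l\<in>UNIV. D l j i * x $ i * y $ l * z $ j)
      = (\<Sum>j\<in>UNIV. \<Sum>i\<in>UNIV. \<Sum>l\<in>UNIV. 1/2 * ((D l j i + D i j l - D i l j) * x $ i * y $ l * z $ j)
         + 1/2 * ((D j l i + D i l j - D i j l) * x $ i * y $ l * z $ j))"
      by (intro sum.cong refl) (simp add: algebra_simps Ds)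
    then show ?thesis
      unfolding sym[of p y] c sw[of x z y] by (simp add: sum.distrib sum_distrib_left)
  qed
  have 0: "((\<lambda>q. \<Sum>i\<in>UNIV. \<Sum>j\<in>UNIV. ?G q i j * Y q $ i * Z q $ j) has_derivative
      (\<lambda>v. \<Sum>i\<in>UNIV. \<Sum>j\<in>UNIV. ?G p i j * Y p $ i * fd Z p v $ j
         + (?G p i j * fd Y p v $ i + fd (\<lambda>q. ?G q i j) p v * Y p $ i) * Z p $ j)) (at p)"
    by (intro has_derivative_sum
        has_derivative_mult[OF has_derivative_mult[OF has_fd[OF dg] has_derivative_nth[OF has_fd[OF dY]]]
          has_derivative_nth[OF has_fd[OF dZ]]])
  have "fd (\<lambda>q. g q (Y q) (Z q)) p (X p) =
      (\<Sum>i\<in>UNIV. \<Sum>j\<in>UNIV. ?G p i j * Y p $ i * fd Z p (X p) $ j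
         + (?G p i j * fd Y p (X p) $ i + fd (\<lambda>q. ?G q i j) p (X p) * Y p $ i) * Z p $ j)"
    by (subst e) (rule fd_eqI[OF 0, of "X p"])
  also have "\<dots> = g p (Y p) (fd Z p (X p)) + g p (fd Y p (X p)) (Z p)
      + (\<Sum>l\<in>UNIV. \<Sum>j\<in>UNIV. \<Sum>i\<in>UNIV. D l j i * X p $ i * Y p $ l * Z p $ j)"
  proof -
    have "fd (\<lambda>q. ?G q i j) p (X p) = (\<Sum>m\<in>UNIV. X p $ m * D i j m)" for i j
      unfolding D_def using fd_expand[OF dg, of i j "X p"] by simp
    then show ?thesis
      unfolding e[of p "Y p" "fd Z p (X p)"] e[of p "fd Y p (X p)" "Z p"]
      by (simp add: sum.distrib distrib_left distrib_right sum_distrib_left sum_distrib_right mult_ac)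
  qed
  also have "(\<Sum>l\<in>UNIV. \<Sum>j\<in>UNIV. \<Sum>i\<in>UNIV. D l j i * X p $ i * Y p $ l * Z p $ j)
     = (\<Sum>j\<in>UNIV. \<Sum>i\<in>UNIV. \<Sum>l\<in>UNIV. D l j i * X p $ i * Y p $ l * Z p $ j)"
    by (rule sum_rot3)
  finally show ?thesis
    unfolding nabla_def bilinear_ladd[OF bil] bilinear_radd[OF bil]
    using s[of "X p" "Y p" "Z p"] by simp
qed
lemma deriv_line:
  fixes f :: "real^'n \<Rightarrow> real"
  assumes "f differentiable at (c + x *\<^sub>R u)"
  shows "((\<lambda>x. f (c + x *\<^sub>R u)) has_field_derivative fd f (c + x *\<^sub>R u) u) (at x)"
proof -
  have "((\<lambda>x. c + x *\<^sub>R u) has_derivative (\<lambda>h. h *\<^sub>R u)) (at x)"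
    by (auto intro!: derivative_eq_intros)
  from has_derivative_compose[OF this has_fd[OF assms]]
  have "((\<lambda>x. f (c + x *\<^sub>R u)) has_derivative (\<lambda>h. fd f (c + x *\<^sub>R u) (h *\<^sub>R u))) (at x)" .
  moreover have "(\<lambda>h. fd f (c + x *\<^sub>R u) (h *\<^sub>R u)) = (*) (fd f (c + x *\<^sub>R u) u)"
    using linear_scale[OF linear_frechet_derivative[OF assms]] by (auto simp: mult.commute)
  ultimately show ?thesis by (simp add: has_field_derivative_def)
qed

lemma second_difference:
  fixes f :: "real^'n \<Rightarrow> real"
  assumes f: "\<And>q. f differentiable at q" and fu: "\<And>q. (\<lambda>q. fd f q u) differentiable at q"
    and s: "0 < s"
  shows "\<exists>a b. 0 < a \<and> a < s \<and> 0 < b \<and> b < s \<and>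
    f (p + s *\<^sub>R u + s *\<^sub>R v) - f (p + s *\<^sub>R u) - f (p + s *\<^sub>R v) + f p
      = s * s * fd (\<lambda>q. fd f q u) (p + a *\<^sub>R u + b *\<^sub>R v) v"
proof -
  have "\<exists>a. 0 < a \<and> a < s \<and>
      (f (p + s *\<^sub>R v + s *\<^sub>R u) - f (p + s *\<^sub>R u)) - (f (p + s *\<^sub>R v + 0 *\<^sub>R u) - f (p + 0 *\<^sub>R u))
      = (s - 0) * (fd f (p + s *\<^sub>R v + a *\<^sub>R u) u - fd f (p + a *\<^sub>R u) u)"
    by (rule MVT2[OF s, where f = "\<lambda>x. f (p + s *\<^sub>R v + x *\<^sub>R u) - f (p + x *\<^sub>R u)"])
       (intro DERIV_diff deriv_line f)
  then obtain a where a: "0 < a" "a < s" and 1: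
      "(f (p + s *\<^sub>R v + s *\<^sub>R u) - f (p + s *\<^sub>R u)) - (f (p + s *\<^sub>R v + 0 *\<^sub>R u) - f (p + 0 *\<^sub>R u))
      = (s - 0) * (fd f (p + s *\<^sub>R v + a *\<^sub>R u) u - fd f (p + a *\<^sub>R u) u)"
    by blast
  have "\<exists>b. 0 < b \<and> b < s \<and> fd f (p + a *\<^sub>R u + s *\<^sub>R v) u - fd f (p + a *\<^sub>R u + 0 *\<^sub>R v) u
      = (s - 0) * fd (\<lambda>q. fd f q u) (p + a *\<^sub>R u + b *\<^sub>R v) v"
    by (rule MVT2[OF s, where f = "\<lambda>y. fd f (p + a *\<^sub>R u + y *\<^sub>R v) u"]) (rule deriv_line[OF fu])
  then obtain b where b: "0 < b" "b < s" and 2: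
      "fd f (p + a *\<^sub>R u + s *\<^sub>R v) u - fd f (p + a *\<^sub>R u + 0 *\<^sub>R v) u
      = (s - 0) * fd (\<lambda>q. fd f q u) (p + a *\<^sub>R u + b *\<^sub>R v) v"
    by blast
  have "p + s *\<^sub>R v + a *\<^sub>R u = p + a *\<^sub>R u + s *\<^sub>R v" "p + s *\<^sub>R v + s *\<^sub>R u = p + s *\<^sub>R u + s *\<^sub>R v"
    by simp_all
  with a b 1 2 show ?thesis
    by (intro exI[of _ a] exI[of _ b]) simp
qed

lemma mixed_partials:
  fixes f :: "real^'n \<Rightarrow> real"
  assumes f: "\<And>q. f differentiable at q" and fu: "\<And>q. (\<lambda>q. fd f q u) differentiable at q"
    and fv: "\<And>q. (\<lambda>q. fd f q v) differentiable at q"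
    and cu: "continuous_on UNIV (\<lambda>q. fd (\<lambda>q. fd f q u) q v)"
    and cv: "continuous_on UNIV (\<lambda>q. fd (\<lambda>q. fd f q v) q u)"
  shows "fd (\<lambda>q. fd f q u) p v = fd (\<lambda>q. fd f q v) p u"
proof -
  let ?A = "\<lambda>q. fd (\<lambda>q. fd f q u) q v" and ?B = "\<lambda>q. fd (\<lambda>q. fd f q v) q u"
  define s where "s n = inverse (real (Suc n))" for n
  have s0: "0 < s n" for n by (simp add: s_def)
  have sl: "s \<longlonglongrightarrow> 0" unfolding s_def by (rule LIMSEQ_inverse_real_of_nat)
  have "\<exists>a b c d. 0 < a \<and> a < s n \<and> 0 < b \<and> b < s n \<and> 0 < c \<and> c < s n \<and> 0 < d \<and> d < s n \<and>
      ?A (p + a *\<^sub>R u + b *\<^sub>R v) = ?B (p + c *\<^sub>R v + d *\<^sub>R u)" for n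
  proof -
    obtain a b where 1: "0 < a" "a < s n" "0 < b" "b < s n"
      "f (p + s n *\<^sub>R u + s n *\<^sub>R v) - f (p + s n *\<^sub>R u) - f (p + s n *\<^sub>R v) + f p
      = s n * s n * ?A (p + a *\<^sub>R u + b *\<^sub>R v)"
      using second_difference[OF f fu s0] by blast
    obtain c d where 2: "0 < c" "c < s n" "0 < d" "d < s n"
      "f (p + s n *\<^sub>R v + s n *\<^sub>R u) - f (p + s n *\<^sub>R v) - f (p + s n *\<^sub>R u) + f p
      = s n * s n * ?B (p + c *\<^sub>R v + d *\<^sub>R u)"
      using second_difference[OF f fv s0] by blast
    have "f (p + s n *\<^sub>R v + s n *\<^sub>R u) = f (p + s n *\<^sub>R u + s n *\<^sub>R v)"
      by (simp add: add_ac)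
    then have "s n * s n * ?A (p + a *\<^sub>R u + b *\<^sub>R v) = s n * s n * ?B (p + c *\<^sub>R v + d *\<^sub>R u)"
      using 1(5) 2(5) by linarith
    then have "?A (p + a *\<^sub>R u + b *\<^sub>R v) = ?B (p + c *\<^sub>R v + d *\<^sub>R u)"
      using s0[of n] by simp
    with 1 2 show ?thesis by blast
  qed
  then obtain a b c d where
    bd: "\<And>n. 0 < a n" "\<And>n. a n < s n" "\<And>n. 0 < b n" "\<And>n. b n < s n"
      "\<And>n. 0 < c n" "\<And>n. c n < s n" "\<And>n. 0 < d n" "\<And>n. d n < s n"
    and eq: "\<And>n. ?A (p + a n *\<^sub>R u + b n *\<^sub>R v) = ?B (p + c n *\<^sub>R v + d n *\<^sub>R u)"
    by metis
  have lim0: "x \<longlonglongrightarrow> 0" if "\<And>n. 0 < x n" "\<And>n. x n < s n" for x :: "nat \<Rightarrow> real"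
    by (rule tendsto_sandwich[OF _ _ tendsto_const sl]) (auto intro!: always_eventually less_imp_le that)
  have "(\<lambda>n. p + a n *\<^sub>R u + b n *\<^sub>R v) \<longlonglongrightarrow> p + 0 *\<^sub>R u + 0 *\<^sub>R v"
    by (intro tendsto_intros lim0 bd)
  then have lA: "(\<lambda>n. ?A (p + a n *\<^sub>R u + b n *\<^sub>R v)) \<longlonglongrightarrow> ?A p"
    using continuous_on_tendsto_compose[OF cu] by simp
  have "(\<lambda>n. p + c n *\<^sub>R v + d n *\<^sub>R u) \<longlonglongrightarrow> p + 0 *\<^sub>R v + 0 *\<^sub>R u"
    by (intro tendsto_intros lim0 bd)
  then have lB: "(\<lambda>n. ?B (p + c n *\<^sub>R v + d n *\<^sub>R u)) \<longlonglongrightarrow> ?B p"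
    using continuous_on_tendsto_compose[OF cv] by simp
  show ?thesis
    using LIMSEQ_unique lA lB unfolding eq by blast
qed

lemma fd_nth:
  fixes f :: "real^'n \<Rightarrow> real^'m"
  shows "f differentiable at q \<Longrightarrow> fd (\<lambda>q. f q $ k) q v = fd f q v $ k"
  by (rule fd_eqI[OF has_derivative_nth[OF has_fd]])

lemma differentiable_nth:
  fixes f :: "real^'n \<Rightarrow> real^'m"
  shows "f differentiable at q \<Longrightarrow> (\<lambda>q. f q $ k) differentiable at q"
  using has_derivative_nth[OF has_fd] differentiableI by blast

lemma Ck2D:
  assumes "Ck 2 f"
  shows "f differentiable at q" "(\<lambda>q. fd f q (axis i 1)) differentiable at q"
    "continuous_on UNIV (\<lambda>q. fd (\<lambda>q. fd f q (axis i 1)) q (axis j 1))"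
  using assms by (auto simp: numeral_2_eq_2 differentiable_on_def)

lemma mixed_partials_vec:
  fixes f :: "real^'n \<Rightarrow> real^'m"
  assumes "Ck 2 f"
  shows "fd (\<lambda>q. fd f q (axis i 1)) p (axis j 1) = fd (\<lambda>q. fd f q (axis j 1)) p (axis i 1)"
proof -
  note C = Ck2D[OF assms]
  have 1: "(\<lambda>q. fd (\<lambda>q. f q $ k) q (axis i 1)) = (\<lambda>q. fd f q (axis i 1) $ k)" for k i
    by (simp add: fd_nth C(1))
  have 2: "fd (\<lambda>q. fd f q (axis i 1) $ k) q (axis j 1) = fd (\<lambda>q. fd f q (axis i 1)) q (axis j 1) $ k"
    for q k i j by (rule fd_nth[OF C(2)])
  have "fd (\<lambda>q. fd (\<lambda>q. f q $ k) q (axis i 1)) p (axis j 1)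
      = fd (\<lambda>q. fd (\<lambda>q. f q $ k) q (axis j 1)) p (axis i 1)" for k
    by (rule mixed_partials; (unfold 1 2)?)
       (auto intro!: differentiable_nth C continuous_on_component)
  then show ?thesis unfolding 1 2 by (simp add: vec_eq_iff)
qed

definition gam :: "('n \<Rightarrow> 'n \<Rightarrow> 'n \<Rightarrow> real) \<Rightarrow> real^'n \<Rightarrow> real^'n \<Rightarrow> real^'n" where
  "gam c x y = (\<chi> k. \<Sum>i\<in>UNIV. \<Sum>j\<in>UNIV. c k i j * x $ i * y $ j)"

lemma gam_linear:
  "gam c (x + x') y = gam c x y + gam c x' y" "gam c (x - x') y = gam c x y - gam c x' y"
  "gam c x (y + y') = gam c x y + gam c x y'" "gam c x (y - y') = gam c x y - gam c x y'"
  by (simp_all add: gam_def vec_eq_iff algebra_simps sum.distrib sum_subtractf)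

lemma has_derivative_vecI:
  fixes f :: "real^'n \<Rightarrow> real^'m"
  assumes "\<And>k. ((\<lambda>q. f q $ k) has_derivative (\<lambda>v. D v $ k)) (at p)"
  shows "(f has_derivative D) (at p)"
  unfolding has_derivative_componentwise_within[of f D p UNIV]
  using assms by (auto simp: Basis_vec_def inner_axis)

lemma fd_nabla:
  fixes Y Z :: "'n::finite vfield"
  assumes Z: "Ck 2 Z" and Y: "Y differentiable at p"
    and G: "\<And>k i j. (\<lambda>q. christoffel g q k i j) differentiable at p"
  shows "fd (nabla g Y Z) p v =
     (\<Sum>i\<in>UNIV. \<Sum>j\<in>UNIV. (Y p $ i * v $ j) *\<^sub>R fd (\<lambda>q. fd Z q (axis i 1)) p (axis j 1))
     + fd Z p (fd Y p v)
     + gam (\<lambda>k i j. fd (\<lambda>q. christoffel g q k i j) p v) (Y p) (Z p)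
     + gam (christoffel g p) (fd Y p v) (Z p) + gam (christoffel g p) (Y p) (fd Z p v)"
proof -
  note C = Ck2D[OF Z]
  have n: "nabla g Y Z = (\<lambda>q. (\<Sum>i\<in>UNIV. Y q $ i *\<^sub>R fd Z q (axis i 1)) + gam (christoffel g q) (Y q) (Z q))"
    by (rule ext) (simp add: nabla_def gam_def fd_expand[OF C(1), of _ "Y _"])
  have 1: "((\<lambda>q. \<Sum>i\<in>UNIV. Y q $ i *\<^sub>R fd Z q (axis i 1)) has_derivative
     (\<lambda>v. \<Sum>i\<in>UNIV. Y p $ i *\<^sub>R fd (\<lambda>q. fd Z q (axis i 1)) p v + fd Y p v $ i *\<^sub>R fd Z p (axis i 1))) (at p)"
    by (intro has_derivative_sum
        has_derivative_scaleR[OF has_derivative_nth[OF has_fd[OF Y]] has_fd[OF C(2)]])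
  have 2: "((\<lambda>q. gam (christoffel g q) (Y q) (Z q)) has_derivative
     (\<lambda>v. gam (\<lambda>k i j. fd (\<lambda>q. christoffel g q k i j) p v) (Y p) (Z p)
        + gam (christoffel g p) (fd Y p v) (Z p) + gam (christoffel g p) (Y p) (fd Z p v))) (at p)"
  proof (rule has_derivative_vecI)
    fix k
    have "((\<lambda>q. \<Sum>i\<in>UNIV. \<Sum>j\<in>UNIV. christoffel g q k i j * Y q $ i * Z q $ j) has_derivative
       (\<lambda>v. \<Sum>i\<in>UNIV. \<Sum>j\<in>UNIV. christoffel g p k i j * Y p $ i * fd Z p v $ j
         + (christoffel g p k i j * fd Y p v $ i + fd (\<lambda>q. christoffel g q k i j) p v * Y p $ i) * Z p $ j)) (at p)"
      by (intro has_derivative_sum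
          has_derivative_mult[OF has_derivative_mult[OF has_fd[OF G] has_derivative_nth[OF has_fd[OF Y]]]
            has_derivative_nth[OF has_fd[OF C(1)]]])
    then show "((\<lambda>q. gam (christoffel g q) (Y q) (Z q) $ k) has_derivative
      (\<lambda>v. (gam (\<lambda>k i j. fd (\<lambda>q. christoffel g q k i j) p v) (Y p) (Z p)
        + gam (christoffel g p) (fd Y p v) (Z p) + gam (christoffel g p) (Y p) (fd Z p v)) $ k)) (at p)"
      by (simp add: gam_def sum.distrib algebra_simps)
  qed
  show ?thesis
    unfolding n fd_eqI[OF has_derivative_add[OF 1 2], of v]
      fd_expand[OF C(2), of _ p v] fd_expand[OF C(1), of p "fd Y p v"]
    by (simp add: sum.distrib scaleR_sum_right)
qed

lemma curvature_formula:
  fixes X Y Z :: "'n::finite vfield"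
  assumes Z: "Ck 2 Z" and X: "X differentiable at p" and Y: "Y differentiable at p"
    and G: "\<And>k i j. (\<lambda>q. christoffel g q k i j) differentiable at p"
  shows "curvature g X Y Z p =
     gam (\<lambda>k i j. fd (\<lambda>q. christoffel g q k i j) p (X p)) (Y p) (Z p)
     - gam (\<lambda>k i j. fd (\<lambda>q. christoffel g q k i j) p (Y p)) (X p) (Z p)
     + gam (christoffel g p) (X p) (gam (christoffel g p) (Y p) (Z p))
     - gam (christoffel g p) (Y p) (gam (christoffel g p) (X p) (Z p))"
proof -
  let ?H = "\<lambda>i j. fd (\<lambda>q. fd Z q (axis i 1)) p (axis j 1)"
  have lin: "linear (frechet_derivative Z (at p))"
    by (rule linear_frechet_derivative[OF Ck2D(1)[OF Z]])
  have n: "nabla g U V p = fd V p (U p) + gam (christoffel g p) (U p) (V p)" for U V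
    by (simp add: nabla_def gam_def)
  have H: "(\<Sum>i\<in>UNIV. \<Sum>j\<in>UNIV. (Y p $ i * X p $ j) *\<^sub>R ?H i j)
      = (\<Sum>i\<in>UNIV. \<Sum>j\<in>UNIV. (X p $ i * Y p $ j) *\<^sub>R ?H i j)"
    by (subst sum.swap) (simp add: mixed_partials_vec[OF Z, of _ p] mult.commute)
  show ?thesis
    unfolding curvature_def n[of X "nabla g Y Z"] n[of Y "nabla g X Z"] n[of "lie_bracket X Y"]
      fd_nabla[OF Z Y G] fd_nabla[OF Z X G] n[of Y Z] n[of X Z] lie_bracket_def H
      linear_diff[OF lin] gam_linear
    by simp
qed

lemma curvature_tensorial:
  fixes X Y Z :: "'n::finite vfield"
  assumes "smooth X" "smooth Y" "smooth Z"
    and G: "\<And>k i j. (\<lambda>q. christoffel g q k i j) differentiable at p"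
  shows "curvature g X Y Z p = curv_op g p (X p) (Y p) (Z p)"
proof -
  have C: "Ck 2 X" "Ck 2 Y" "Ck 2 Z" using assms unfolding smooth_def by blast+
  have "Ck 2 (\<lambda>_. Z p)"
    by (simp add: numeral_2_eq_2)
  note const = curvature_formula[OF this differentiable_const differentiable_const G]
  show ?thesis
    unfolding curv_op_def const
    by (rule curvature_formula[OF C(3) Ck2D(1)[OF C(1)] Ck2D(1)[OF C(2)] G])
qed

text \<open>In the metric, \<open>2 e^{x\<^sub>1} dx\<^sub>2 dx\<^sub>4\<close> denotes the symmetric product, hence the two mixed terms.\<close>

definition godel_metric :: "real \<Rightarrow> real^4 \<Rightarrow> 4 form2" where
  "godel_metric a p u v = a\<^sup>2 * (- (u$1 * v$1) + 1/2 * exp (2 * p$1) * (u$2 * v$2) - u$3 * v$3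
     + u$4 * v$4 + exp (p$1) * (u$2 * v$4 + u$4 * v$2))"

definition godel_form :: "real \<Rightarrow> real^4 \<Rightarrow> real^4 \<Rightarrow> real" where
  "godel_form a p v = a * exp (p$1) * v$2 + a * v$4"

lemma godel_bilinear: "bilinear (godel_metric a p)"
  unfolding bilinear_def godel_metric_def
  by (intro conjI allI linearI) (simp_all add: algebra_simps)

lemma godel_sym: "godel_metric a p u v = godel_metric a p v u"
  by (simp add: godel_metric_def algebra_simps)

definition godel_inv :: "real \<Rightarrow> real^4 \<Rightarrow> 4 \<Rightarrow> 4 \<Rightarrow> real" where
  "godel_inv a p i j = 1 / a\<^sup>2 *
     (if i = 1 \<and> j = 1 \<or> i = 3 \<and> j = 3 \<or> i = 4 \<and> j = 4 then - 1
      else if i = 2 \<and> j = 2 then - 2 * (exp (- p$1))\<^sup>2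
      else if i = 2 \<and> j = 4 \<or> i = 4 \<and> j = 2 then 2 * exp (- p$1) else 0)"

lemma godel_gram_inv:
  assumes "a \<noteq> 0"
  shows "gram (godel_metric a) p ** (\<chi> i j. godel_inv a p i j) = mat 1"
    and "(\<chi> i j. godel_inv a p i j) ** gram (godel_metric a) p = mat 1"
proof -
  define E where "E = exp (p$1)"
  have E: "E \<noteq> 0" "exp (p$1) = E" "exp (- p$1) = 1 / E" "exp (2 * p$1) = E * E" "exp (p$1 * 2) = E * E"
    by (simp_all add: E_def exp_minus inverse_eq_divide flip: exp_add)
  show "gram (godel_metric a) p ** (\<chi> i j. godel_inv a p i j) = mat 1"
    and "(\<chi> i j. godel_inv a p i j) ** gram (godel_metric a) p = mat 1"
    using assms E(1)
    by (simp_all add: vec_eq_iff forall_4 matrix_matrix_mult_def sum_4 gram_def godel_metric_def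
        godel_inv_def mat_def axis_def E(2-) power2_eq_square field_simps)
qed

lemma godel_gram_invertible: "a \<noteq> 0 \<Longrightarrow> invertible (gram (godel_metric a) p)"
  unfolding invertible_def using godel_gram_inv by blast

lemma godel_matrix_inv:
  assumes "a \<noteq> 0"
  shows "matrix_inv (gram (godel_metric a) p) = (\<chi> i j. godel_inv a p i j)" (is "?J = ?K")
proof -
  have "?J ** gram (godel_metric a) p = mat 1"
    using godel_gram_invertible[OF assms] unfolding invertible_def matrix_inv_def
    by (rule someI2_ex) simp
  then have "?J = ?J ** (gram (godel_metric a) p ** ?K)"
    by (simp add: godel_gram_inv[OF assms])
  also have "\<dots> = ?K"
    using \<open>?J ** gram (godel_metric a) p = mat 1\<close> by (simp add: matrix_mul_assoc)
  finally show ?thesis .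
qed

lemma has_derivative_godel_gram:
  "((\<lambda>q. gram (godel_metric a) q $ i $ j) has_derivative
     (\<lambda>v. a\<^sup>2 * v$1 * (exp (2 * p$1) * axis i 1 $ 2 * axis j 1 $ 2
        + exp (p$1) * (axis i 1 $ 2 * axis j 1 $ 4 + axis i 1 $ 4 * axis j 1 $ 2)))) (at p)"
proof -
  have h: "((\<lambda>q::real^4. q $ 1) has_derivative (\<lambda>v. v $ 1)) (at p)"
    by (rule bounded_linear_imp_has_derivative[OF bounded_linear_vec_nth])
  show ?thesis
    unfolding gram_def godel_metric_def vec_lambda_beta
    by (rule h derivative_eq_intros refl)+ (simp add: algebra_simps)
qed

lemma godel_christoffel_differentiable:
  assumes "a \<noteq> 0"
  shows "(\<lambda>q. christoffel (godel_metric a) q k i j) differentiable at p"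
proof -
  have h: "(\<lambda>q::real^4. q $ 1) differentiable at p"
    using bounded_linear_imp_has_derivative[OF bounded_linear_vec_nth] differentiableI by blast
  have e: "(\<lambda>q::real^4. exp (c * q $ 1)) differentiable at p" for c :: real
  proof -
    obtain D where D: "((\<lambda>q::real^4. q $ 1) has_derivative D) (at p)"
      using h unfolding differentiable_def by blast
    have "((\<lambda>q::real^4. exp (c * q $ 1)) has_derivative (\<lambda>v. exp (c * p $ 1) * (c * D v))) (at p)"
      by (rule D derivative_eq_intros refl)+ (simp add: mult_ac)
    then show ?thesis by (rule differentiableI)
  qed
  have e1: "(\<lambda>q::real^4. exp (q $ 1)) differentiable at p" using e[of 1] by simp
  have em: "(\<lambda>q::real^4. exp (- q $ 1)) differentiable at p" using e[of "-1"] by simp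
  have J: "(\<lambda>q. godel_inv a q k l) differentiable at p" for k l
  proof -
    have i: "(\<lambda>q. if P then f q else g q) differentiable at p"
      if "f differentiable at p" "g differentiable at p" for P and f g :: "real^4 \<Rightarrow> real"
      using that by (cases P) simp_all
    show ?thesis
      unfolding godel_inv_def power2_eq_square
      by (intro differentiable_mult i differentiable_const em)
  qed
  have fd: "fd (\<lambda>q. gram (godel_metric a) q $ i $ j) q v =
      a\<^sup>2 * v$1 * (exp (2 * q$1) * axis i 1 $ 2 * axis j 1 $ 2
        + exp (q$1) * (axis i 1 $ 2 * axis j 1 $ 4 + axis i 1 $ 4 * axis j 1 $ 2))" for i j q v
    by (rule fd_eqI[OF has_derivative_godel_gram])
  show ?thesis
    unfolding christoffel_def godel_matrix_inv[OF assms] fd vec_lambda_beta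
    by (intro differentiable_mult differentiable_sum differentiable_add differentiable_diff
        differentiable_const J e e1 finite ballI)
qed

end

theory Submission
  imports Defs
begin

text \<open>
  In the coframe \<open>\<theta>\<^sub>1 = dx\<^sub>1\<close>, \<open>\<theta>\<^sub>2 = e^{x\<^sub>1} dx\<^sub>2\<close>, \<open>\<theta>\<^sub>3 = dx\<^sub>3\<close>,
  \<open>\<theta>\<^sub>4 = dx\<^sub>4 + e^{x\<^sub>1} dx\<^sub>2\<close> the metric is \<open>a\<^sup>2\<close> times a constant diagonal form, all curvature
  tensors have constant components, \<open>S = \<theta>\<^sub>4 \<otimes> \<theta>\<^sub>4\<close> and \<open>\<omega> = a \<theta>\<^sub>4\<close>. With
  \<open>m\<^sub>i\<^sub>j = \<theta>\<^sub>i \<and> \<theta>\<^sub>j\<close> one finds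
  \<open>R = a\<^sup>2 (m\<^sub>1\<^sub>2\<^sup>2 / 4 + m\<^sub>1\<^sub>4\<^sup>2 / 2 + m\<^sub>2\<^sub>4\<^sup>2 / 4)\<close> and
  \<open>conh(R) = a\<^sup>2 (m\<^sub>1\<^sub>2\<^sup>2 / 4 - m\<^sub>3\<^sub>4\<^sup>2 / 2)\<close>. The conharmonic operator is therefore a combination of a
  rotation of the \<open>1,2\<close>-plane and a boost of the \<open>3,4\<close>-plane; both annihilate \<open>g\<close>, \<open>m\<^sub>1\<^sub>2\<close> and
  \<open>m\<^sub>3\<^sub>4\<close>, whence (5). Since \<open>C\<close> differs from \<open>conh(R)\<close> by \<open>\<kappa>/6\<close> times the constant curvature tensor
  of \<open>g\<close>, which every skew operator annihilates, (6) follows from (5). Finally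
  \<open>(\<nabla>\<^sub>X \<theta>\<^sub>4)(Y) = m\<^sub>1\<^sub>2(X, Y) / 2\<close> is skew, so the cyclic sum in (1) cancels.
\<close>

section \<open>Christoffel symbols of the Goedel metric and their derivatives\<close>

lemma vector_4:
  "(vector [w,x,y,z] :: 'a::zero^4) $ 1 = w" "(vector [w,x,y,z] :: 'a^4) $ 2 = x"
  "(vector [w,x,y,z] :: 'a^4) $ 3 = y" "(vector [w,x,y,z] :: 'a^4) $ 4 = z"
  by (simp_all add: vector_def)

text \<open>The indicator \<open>s\<close> treats the lower indices as an unordered pair, so each
  summand accounts for both mirror-image symbols at once.\<close>

definition godel_chr :: "real^4 \<Rightarrow> 4 \<Rightarrow> 4 \<Rightarrow> 4 \<Rightarrow> real" where
  "godel_chr p k i j = (let s = (\<lambda>l m n. of_bool (k = l \<and> (i = m \<and> j = n \<or> i = n \<and> j = m))) in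
     1/2 * exp (2 * p$1) * s 1 2 2 + 1/2 * exp (p$1) * s 1 2 4 - exp (- p$1) * s 2 1 4
     + 1/2 * exp (p$1) * s 4 1 2 + s 4 1 4)"

text \<open>The constant factor a^2 cancels between the Gram matrix and its inverse, so the symbols
  do not depend on \<open>a\<close>.\<close>

lemma godel_christoffel:
  assumes "a \<noteq> 0"
  shows "christoffel (godel_metric a) p k i j = godel_chr p k i j"
proof -
  \<comment> \<open>One nonzero variable in place of all exponentials turns the goals into rational
    identities within reach of \<open>field_simps\<close>.\<close>
  define E where "E = exp (p$1)"
  have E: "E \<noteq> 0" "exp (p$1) = E" "exp (- p$1) = 1 / E" "exp (2 * p$1) = E * E" "exp (p$1 * 2) = E * E"
    by (simp_all add: E_def exp_minus inverse_eq_divide flip: exp_add)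
  have fd: "fd (\<lambda>q. gram (godel_metric a) q $ i $ j) p v =
      a\<^sup>2 * v$1 * (exp (2 * p$1) * axis i 1 $ 2 * axis j 1 $ 2
        + exp (p$1) * (axis i 1 $ 2 * axis j 1 $ 4 + axis i 1 $ 4 * axis j 1 $ 2))" for i j v
    by (rule fd_eqI[OF has_derivative_godel_gram])
  have "\<forall>k i j. christoffel (godel_metric a) p k i j = godel_chr p k i j"
    unfolding christoffel_def godel_matrix_inv[OF assms] fd vec_lambda_beta
    using assms E(1)
    by (simp add: forall_4 sum_4 godel_inv_def godel_chr_def axis_def E(2-) power2_eq_square field_simps)
  then show ?thesis by blast
qed

lemma gam_godel_chr:
  "gam (godel_chr p) x y = vector
     [exp (2 * p$1) / 2 * (x$2 * y$2) + exp (p$1) / 2 * (x$2 * y$4 + x$4 * y$2),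
      - exp (- p$1) * (x$1 * y$4 + x$4 * y$1), 0,
      exp (p$1) / 2 * (x$1 * y$2 + x$2 * y$1) + x$1 * y$4 + x$4 * y$1]"
  by (simp add: gam_def vec_eq_iff forall_4 sum_4 godel_chr_def algebra_simps vector_4)

lemma fd_godel_chr:
  "fd (\<lambda>q. godel_chr q k i j) p v = v$1 *
    (let s = (\<lambda>l m n. of_bool (k = l \<and> (i = m \<and> j = n \<or> i = n \<and> j = m))) in
     exp (2 * p$1) * s 1 2 2 + exp (p$1) / 2 * s 1 2 4 + exp (- p$1) * s 2 1 4
     + exp (p$1) / 2 * s 4 1 2)"
proof (rule fd_eqI)
  have h: "((\<lambda>q::real^4. q $ 1) has_derivative (\<lambda>v. v $ 1)) (at p)"
    by (rule bounded_linear_imp_has_derivative[OF bounded_linear_vec_nth])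
  show "((\<lambda>q. godel_chr q k i j) has_derivative (\<lambda>v. v$1 *
    (let s = (\<lambda>l m n. of_bool (k = l \<and> (i = m \<and> j = n \<or> i = n \<and> j = m))) in
     exp (2 * p$1) * s 1 2 2 + exp (p$1) / 2 * s 1 2 4 + exp (- p$1) * s 2 1 4
     + exp (p$1) / 2 * s 4 1 2))) (at p)"
    unfolding godel_chr_def Let_def
    by (rule h derivative_eq_intros refl)+ (simp add: algebra_simps)
qed

lemma gam_fd_godel_chr:
  "gam (\<lambda>k i j. fd (\<lambda>q. godel_chr q k i j) p v) x y = v$1 *\<^sub>R vector
     [exp (2 * p$1) * (x$2 * y$2) + exp (p$1) / 2 * (x$2 * y$4 + x$4 * y$2),
      exp (- p$1) * (x$1 * y$4 + x$4 * y$1), 0,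
      exp (p$1) / 2 * (x$1 * y$2 + x$2 * y$1)]"
  by (simp add: gam_def vec_eq_iff forall_4 sum_4 fd_godel_chr algebra_simps vector_4)

section \<open>The coframe and the curvature operator in it\<close>

definition coframe :: "real^4 \<Rightarrow> real^4 \<Rightarrow> real^4" where
  "coframe p v = vector [v$1, exp (p$1) * v$2, v$3, v$4 + exp (p$1) * v$2]"

definition minor :: "'n \<Rightarrow> 'n \<Rightarrow> real^'n \<Rightarrow> real^'n \<Rightarrow> real" where
  "minor i j x y = x$i * y$j - x$j * y$i"

lemma coframe_nth:
  "coframe p v $ 1 = v$1" "coframe p v $ 2 = exp (p$1) * v$2"
  "coframe p v $ 3 = v$3" "coframe p v $ 4 = v$4 + exp (p$1) * v$2"
  by (simp_all add: coframe_def vector_4)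

lemma linear_coframe: "linear (coframe p)"
  by (rule linearI) (simp_all add: vec_eq_iff forall_4 coframe_nth algebra_simps)

definition frame_metric :: "4 form2" where
  "frame_metric u v = - (u$1 * v$1) - u$2 * v$2 / 2 - u$3 * v$3 + u$4 * v$4"

text \<open>Completing the square absorbs the mixed term into theta_4^2; what is left over is the
  -1/2 in front of theta_2^2.\<close>

lemma godel_metric_coframe:
  "godel_metric a p u v = a\<^sup>2 * frame_metric (coframe p u) (coframe p v)"
proof -
  have "exp (2 * p$1) = exp (p$1) * exp (p$1)" by (simp flip: exp_add)
  then show ?thesis
    by (simp add: godel_metric_def frame_metric_def coframe_nth field_simps)
qed

text \<open>\<open>coframe p\<close> intertwines an operator at \<open>p\<close> with a model
  \<open>D'\<close>. The models used below do not depend on the point, so tensor identities become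
  polynomial identities with constant coefficients.\<close>

definition in_coframe :: "real^4 \<Rightarrow> 4 endo2 \<Rightarrow> 4 endo2 \<Rightarrow> bool" where
  "in_coframe p D D' \<longleftrightarrow>
     (\<forall>x y z. coframe p (D x y z) = D' (coframe p x) (coframe p y) (coframe p z))"

definition frame_curv :: "4 endo2" where
  "frame_curv x y z = vector
     [minor 1 2 x y * z$2 / 4 + minor 1 4 x y * z$4 / 2,
      - (minor 1 2 x y * z$1) / 2 + minor 2 4 x y * z$4 / 2, 0,
      minor 1 4 x y * z$1 / 2 + minor 2 4 x y * z$2 / 4]"

text \<open>On constant fields \<open>curvature_formula\<close> leaves the derivatives of the
  Christoffel symbols and their quadratic terms, both known explicitly.\<close>

lemma coframe_curv_op:
  assumes "a \<noteq> 0"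
  shows "in_coframe p (curv_op (godel_metric a) p) frame_curv"
proof -
  define E where "E = exp (p$1)"
  have E: "E \<noteq> 0" "exp (p$1) = E" "exp (- p$1) = 1 / E" "exp (2 * p$1) = E * E" "exp (p$1 * 2) = E * E"
    by (simp_all add: E_def exp_minus inverse_eq_divide flip: exp_add)
  have C: "christoffel (godel_metric a) = godel_chr"
    by (intro ext godel_christoffel[OF assms])
  have "Ck 2 (\<lambda>_::real^4. z)" for z :: "real^4"
    by (simp add: numeral_2_eq_2)
  then have f: "curvature (godel_metric a) (\<lambda>_. x) (\<lambda>_. y) (\<lambda>_. z) p =
     gam (\<lambda>k i j. fd (\<lambda>q. godel_chr q k i j) p x) y z
     - gam (\<lambda>k i j. fd (\<lambda>q. godel_chr q k i j) p y) x z
     + gam (godel_chr p) x (gam (godel_chr p) y z)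
     - gam (godel_chr p) y (gam (godel_chr p) x z)" for x y z
    using curvature_formula[of "\<lambda>_. z" "\<lambda>_. x" p "\<lambda>_. y" "godel_metric a"]
      godel_christoffel_differentiable[OF assms] by (simp add: C)
  show ?thesis
    unfolding in_coframe_def curv_op_def f gam_fd_godel_chr gam_godel_chr
    using E(1)
    by (simp add: vec_eq_iff forall_4 coframe_nth frame_curv_def minor_def vector_4 E(2-) field_simps)
qed


section \<open>Ricci tensor, Ricci operator and scalar curvature\<close>

lemma coframe_nth_inv:
  "v $ 1 = coframe p v $ 1" "v $ 2 = coframe p v $ 2 / exp (p$1)"
  "v $ 3 = coframe p v $ 3" "v $ 4 = coframe p v $ 4 - coframe p v $ 2"
  by (simp_all add: coframe_nth)

lemma coframe_axis4: "coframe p (axis 4 1) = axis 4 1"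
  by (simp add: vec_eq_iff forall_4 coframe_nth axis_def)

text \<open>The trace is taken in the coordinate basis, so the coframe components are first
  converted back. The products of first and of second components then cancel.\<close>

lemma godel_ricci:
  assumes "a \<noteq> 0"
  shows "ricci (godel_metric a) p y z = coframe p y $ 4 * coframe p z $ 4"
  unfolding ricci_def trace_def matrix_def
  by (simp add: sum_4 coframe_nth_inv(1,3,4)[of "curv_op _ _ _ _ _" p]
      coframe_nth_inv(2)[of "curv_op _ _ _ _ _" p] coframe_curv_op[OF assms, unfolded in_coframe_def])
     (simp add: frame_curv_def minor_def vector_4 coframe_nth axis_def field_simps)

text \<open>Supplies the uniqueness required by the definite description in \<open>ricci_op\<close>;
  testing against the four basis vectors suffices.\<close>

lemma godel_nondegenerate:
  assumes "a \<noteq> 0" "\<And>x. godel_metric a p x u = godel_metric a p x v"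
  shows "u = v"
proof -
  define E where "E = exp (p$1)"
  have E: "E \<noteq> 0" "exp (p$1) = E" "exp (2 * p$1) = E * E" "exp (p$1 * 2) = E * E"
    by (simp_all add: E_def flip: exp_add)
  have "\<forall>i. godel_metric a p (axis i 1) u = godel_metric a p (axis i 1) v"
    using assms(2) by blast
  then have m: "u$1 = v$1" "u$3 = v$3" "a\<^sup>2 * (u$4 + E * u$2) = a\<^sup>2 * (v$4 + E * v$2)"
    "a\<^sup>2 * (E * (E * u$2 / 2 + u$4)) = a\<^sup>2 * (E * (E * v$2 / 2 + v$4))"
    using assms(1) by (simp_all add: forall_4 godel_metric_def axis_def E(2-) algebra_simps)
  then have 1: "u$1 = v$1" "u$3 = v$3" "u$4 + E * u$2 = v$4 + E * v$2"
    and 2: "E * (E * u$2 / 2 + u$4) = E * (E * v$2 / 2 + v$4)"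
    using assms(1) by (simp_all only: mult_cancel_left power_eq_0_iff simp_thms)
  from 2 have "E * u$2 / 2 + u$4 = E * v$2 / 2 + v$4"
    using E(1) by simp
  with 1 have "E * u$2 = E * v$2" "u$4 = v$4" by linarith+
  with 1 E(1) show ?thesis by (simp add: vec_eq_iff forall_4)
qed

text \<open>The vector \<open>axis 4 1\<close> is metrically dual to a^2 theta_4, whence the factor
  1/a^2.\<close>

lemma godel_ricci_op:
  assumes "a \<noteq> 0"
  shows "ricci_op (godel_metric a) p y = (coframe p y $ 4 / a\<^sup>2) *\<^sub>R axis 4 1"
  unfolding ricci_op_def
proof (rule the_equality)
  show *: "\<forall>x. godel_metric a p x ((coframe p y $ 4 / a\<^sup>2) *\<^sub>R axis 4 1) = ricci (godel_metric a) p x y"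
    using assms by (simp add: godel_ricci godel_metric_coframe linear_scale[OF linear_coframe]
        coframe_axis4 frame_metric_def) (simp add: axis_def)
  fix v assume "\<forall>x. godel_metric a p x v = ricci (godel_metric a) p x y"
  then show "v = (coframe p y $ 4 / a\<^sup>2) *\<^sub>R axis 4 1"
    using * by (intro godel_nondegenerate[OF assms, of p]) simp
qed

lemma godel_scalar_curv:
  assumes "a \<noteq> 0"
  shows "scalar_curv (godel_metric a) p = 1 / a\<^sup>2"
  by (simp add: scalar_curv_def trace_def matrix_def godel_ricci_op[OF assms] sum_4 coframe_nth axis_def)

section \<open>Conharmonic and Weyl operators in the coframe\<close>

definition frame_conh :: "4 endo2" where
  "frame_conh x y z = vector
     [minor 1 2 x y * z$2 / 4, - (minor 1 2 x y * z$1) / 2,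
      - (minor 3 4 x y * z$4) / 2, - (minor 3 4 x y * z$3) / 2]"

text \<open>The coefficient is a^2 kappa / ((n-1)(n-2)) for n = 4 and kappa = 1/a^2, with a^2 the
  scale of the metric over \<open>frame_metric\<close>.\<close>

definition frame_weyl :: "4 endo2" where
  "frame_weyl x y z = frame_conh x y z + (1/6) *\<^sub>R wedge frame_metric x y z"

lemma coframe_wedge:
  assumes "\<And>u v. A u v = c * B (coframe p u) (coframe p v)"
  shows "in_coframe p (wedge A) (\<lambda>x y z. c *\<^sub>R wedge B x y z)"
  by (simp add: in_coframe_def wedge_def linear_diff[OF linear_coframe] linear_scale[OF linear_coframe]
      assms scaleR_diff_right)

lemma coframe_wedge_metric:
  "in_coframe p (wedge (godel_metric a p)) (\<lambda>x y z. a\<^sup>2 *\<^sub>R wedge frame_metric x y z)"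
  by (rule coframe_wedge) (rule godel_metric_coframe)

lemma coframe_wedge_ricci:
  assumes "a \<noteq> 0"
  shows "in_coframe p (wedge (ricci (godel_metric a) p)) (wedge (\<lambda>u v. u$4 * v$4))"
  using coframe_wedge[of "ricci (godel_metric a) p" 1 "\<lambda>u v. u$4 * v$4" p]
  by (simp add: godel_ricci[OF assms])

lemma coframe_conh_op:
  assumes "a \<noteq> 0"
  shows "in_coframe p (conh_op (godel_metric a) p) frame_conh"
  using assms
  unfolding conh_op_def wedge_def godel_ricci_op[OF assms] godel_metric_coframe
    linear_diff[OF linear_coframe] linear_add[OF linear_coframe]
    linear_scale[OF linear_coframe] coframe_curv_op[OF assms, unfolded in_coframe_def, rule_format]
    coframe_axis4 in_coframe_def
  by (simp add: vec_eq_iff forall_4 frame_conh_def frame_curv_def vector_4 minor_def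
      frame_metric_def axis_def algebra_simps add_divide_distrib diff_divide_distrib)

lemma coframe_weyl_op:
  assumes "a \<noteq> 0"
  shows "in_coframe p (weyl_op (godel_metric a) p) frame_weyl"
proof -
  have "weyl_op (godel_metric a) p x y z
      = conh_op (godel_metric a) p x y z + (1 / (6 * a\<^sup>2)) *\<^sub>R wedge (godel_metric a p) x y z" for x y z
    by (simp add: weyl_op_def conh_op_def godel_scalar_curv[OF assms] algebra_simps)
  then show ?thesis
    using assms coframe_conh_op[OF assms, of p] coframe_wedge_metric[of p a]
    by (simp add: in_coframe_def frame_weyl_def
        linear_add[OF linear_coframe] linear_scale[OF linear_coframe])
qed

section \<open>Derivation actions on the lowered frame tensors\<close>

definition frame_lower :: "4 endo2 \<Rightarrow> 4 form4" where
  "frame_lower D x y z w = frame_metric (D x y z) w"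

lemma lower_coframe:
  assumes "in_coframe p D D'"
  shows "lower (godel_metric a) p D x y z w
    = a\<^sup>2 * frame_lower D' (coframe p x) (coframe p y) (coframe p z) (coframe p w)"
  using assms by (simp add: in_coframe_def lower_def frame_lower_def godel_metric_coframe)

text \<open>Transfer principle: \<open>act\<close> only inserts operator values into tensor slots,
  so it commutes with the passage to the frame.\<close>

lemma act_lower_coframe:
  assumes "in_coframe p D D'" "in_coframe p E E'"
  shows "act D (lower (godel_metric a) p E) x1 x2 x3 x4 x y
    = a\<^sup>2 * act D' (frame_lower E') (coframe p x1) (coframe p x2) (coframe p x3)
        (coframe p x4) (coframe p x) (coframe p y)"
  using assms(1) unfolding act_def lower_coframe[OF assms(2)]
  by (simp add: in_coframe_def algebra_simps)

lemma frame_lower_curv: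
  "frame_lower frame_curv x y z w =
     minor 1 2 x y * minor 1 2 z w / 4 + minor 1 4 x y * minor 1 4 z w / 2
     + minor 2 4 x y * minor 2 4 z w / 4"
  by (simp add: frame_lower_def frame_curv_def frame_metric_def minor_def vector_4 algebra_simps
      add_divide_distrib diff_divide_distrib)

lemma frame_lower_conh:
  "frame_lower frame_conh x y z w =
     minor 1 2 x y * minor 1 2 z w / 4 - minor 3 4 x y * minor 3 4 z w / 2"
  by (simp add: frame_lower_def frame_conh_def frame_metric_def minor_def vector_4 algebra_simps
      add_divide_distrib diff_divide_distrib)

lemma frame_metric_linear:
  "frame_metric (u + v) w = frame_metric u w + frame_metric v w"
  "frame_metric (u - v) w = frame_metric u w - frame_metric v w"
  "frame_metric (c *\<^sub>R u) w = c * frame_metric u w"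
  "frame_metric w (u + v) = frame_metric w u + frame_metric w v"
  "frame_metric w (u - v) = frame_metric w u - frame_metric w v"
  "frame_metric w (c *\<^sub>R u) = c * frame_metric w u"
  by (simp_all add: frame_metric_def algebra_simps add_divide_distrib diff_divide_distrib)

lemma frame_lower_wedge:
  "frame_lower (wedge frame_metric) x y z w
    = frame_metric y z * frame_metric x w - frame_metric x z * frame_metric y w"
  by (simp add: frame_lower_def wedge_def frame_metric_linear)

lemma frame_metric_sym: "frame_metric u v = frame_metric v u"
  by (simp add: frame_metric_def)

lemma frame_lower_weyl:
  "frame_lower frame_weyl x y z w
    = frame_lower frame_conh x y z w + frame_lower (wedge frame_metric) x y z w / 6"
  by (simp add: frame_lower_def frame_weyl_def frame_metric_linear)

text \<open>Both operators act as derivations on the three 2-forms making up R. On the left the m_24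
  m_14 products cancel; the m_12 m_14 and m_12 m_24 products add up to those on the right.\<close>

lemma act_curv_curv:
  "act frame_curv (frame_lower frame_curv) x1 x2 x3 x4 x y
    = act (wedge (\<lambda>u v. u$4 * v$4)) (frame_lower frame_curv) x1 x2 x3 x4 x y"
proof -
  let ?R = "frame_curv x y" and ?W = "wedge (\<lambda>u v. u$4 * v$4) x y"
  \<comment> \<open>Moving the operator to the other argument of a 2-form costs the derivative of
    that form, again a combination of the three minors.\<close>
  have R:
    "minor 1 2 (?R u) v = (minor 2 4 x y * minor 1 4 u v - minor 1 4 x y * minor 2 4 u v) / 2
      - minor 1 2 u (?R v)"
    "minor 1 4 (?R u) v = (minor 1 2 x y * minor 2 4 u v + minor 2 4 x y * minor 1 2 u v) / 4
      - minor 1 4 u (?R v)"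
    "minor 2 4 (?R u) v = - (minor 1 2 x y * minor 1 4 u v + minor 1 4 x y * minor 1 2 u v) / 2
      - minor 2 4 u (?R v)" for u v
    by (simp_all add: frame_curv_def minor_def vector_4 algebra_simps add_divide_distrib diff_divide_distrib)
  \<comment> \<open>Here m_14 and m_24 are annihilated and only m_12 has a nonzero
    derivative.\<close>
  have W:
    "minor 1 2 (?W u) v = minor 2 4 x y * minor 1 4 u v - minor 1 4 x y * minor 2 4 u v
      - minor 1 2 u (?W v)"
    "minor 1 4 (?W u) v = - minor 1 4 u (?W v)"
    "minor 2 4 (?W u) v = - minor 2 4 u (?W v)" for u v
    by (simp_all add: wedge_def minor_def algebra_simps)
  show ?thesis
    unfolding act_def frame_lower_curv R W by (simp add: field_simps)
qed

lemma act_conh_conh: "act frame_conh (frame_lower frame_conh) x1 x2 x3 x4 x y = 0"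
proof -
  have m: "minor 1 2 (frame_conh x y u) v = - minor 1 2 u (frame_conh x y v)"
    "minor 3 4 (frame_conh x y u) v = - minor 3 4 u (frame_conh x y v)" for u v
    by (simp_all add: frame_conh_def minor_def vector_4 field_simps)
  show ?thesis
    unfolding act_def frame_lower_conh m by simp
qed

text \<open>\<open>frame_lower (wedge frame_metric)\<close> is the constant curvature tensor of the frame metric.\<close>

lemma act_skew_wedge:
  assumes "\<And>u v. frame_metric (D x y u) v = - frame_metric u (D x y v)"
  shows "act D (frame_lower (wedge frame_metric)) x1 x2 x3 x4 x y = 0"
  unfolding act_def frame_lower_wedge assms by (simp add: algebra_simps)

lemma wedge_frame_metric_skew:
  "frame_metric (wedge frame_metric x y u) v = - frame_metric u (wedge frame_metric x y v)"
  by (simp add: wedge_def frame_metric_linear frame_metric_sym)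

lemma frame_conh_skew: "frame_metric (frame_conh x y u) v = - frame_metric u (frame_conh x y v)"
  by (simp add: frame_conh_def frame_metric_def vector_4 algebra_simps)

lemma act_conh_weyl: "act frame_conh (frame_lower frame_weyl) x1 x2 x3 x4 x y = 0"
  using act_conh_conh[of x1 x2 x3 x4 x y]
    act_skew_wedge[of frame_conh x y x1 x2 x3 x4, OF frame_conh_skew]
  by (simp add: act_def frame_lower_weyl)


lemma minor_linear:
  "minor i j (u + v) w = minor i j u w + minor i j v w"
  "minor i j (c *\<^sub>R u) w = c * minor i j u w"
  "minor i j w (u + v) = minor i j w u + minor i j w v"
  "minor i j w (c *\<^sub>R u) = c * minor i j w u"
  by (simp_all add: minor_def algebra_simps)

text \<open>The conharmonic part of the operator annihilates \<open>conh(R)\<close>, leaving Q(g,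
  conh(R))/6. This is Q(g, C)/6, because the skew wedge operator annihilates the constant curvature
  part of C.\<close>

lemma act_weyl_conh:
  "act frame_weyl (frame_lower frame_conh) x1 x2 x3 x4 x y
    = act (wedge frame_metric) (frame_lower frame_weyl) x1 x2 x3 x4 x y / 6"
proof -
  have "act frame_weyl (frame_lower frame_conh) x1 x2 x3 x4 x y
    = act frame_conh (frame_lower frame_conh) x1 x2 x3 x4 x y
      + act (wedge frame_metric) (frame_lower frame_conh) x1 x2 x3 x4 x y / 6"
    unfolding act_def frame_lower_conh frame_weyl_def minor_linear
    by (simp add: algebra_simps add_divide_distrib diff_divide_distrib)
  moreover have "act (wedge frame_metric) (frame_lower frame_weyl) x1 x2 x3 x4 x y
    = act (wedge frame_metric) (frame_lower frame_conh) x1 x2 x3 x4 x y"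
    using act_skew_wedge[of "wedge frame_metric" x y x1 x2 x3 x4, OF wedge_frame_metric_skew]
    by (simp add: act_def frame_lower_weyl)
  ultimately show ?thesis
    by (simp add: act_conh_conh)
qed

lemma frame_weyl_skew: "frame_metric (frame_weyl x y u) v = - frame_metric u (frame_weyl x y v)"
  by (simp add: frame_weyl_def frame_metric_linear
      frame_conh_skew[of _ _ u] wedge_frame_metric_skew[of _ _ u])

lemma act_weyl_weyl:
  "act frame_weyl (frame_lower frame_weyl) x1 x2 x3 x4 x y
    = act frame_weyl (frame_lower frame_conh) x1 x2 x3 x4 x y"
  using act_skew_wedge[of frame_weyl x y x1 x2 x3 x4, OF frame_weyl_skew]
  by (simp add: act_def frame_lower_weyl)

section \<open>Pseudosymmetry, Riemann compatibility, rank of S and compatibility of the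
  form\<close>

lemma godel_act_curv:
  assumes "a \<noteq> 0"
  shows "act (curv_op (godel_metric a) p) (riem (godel_metric a) p)
    = tachibana (ricci (godel_metric a) p) (riem (godel_metric a) p)"
  by (intro ext)
     (simp only: tachibana_def riem_def act_curv_curv
        act_lower_coframe[OF coframe_curv_op[OF assms] coframe_curv_op[OF assms]]
        act_lower_coframe[OF coframe_wedge_ricci[OF assms] coframe_curv_op[OF assms]])

text \<open>The Ricci operator has values in the line of \<open>axis 4 1\<close>, so only the m_14
  and m_24 terms of R survive. The cyclic sum is a combination of the 3-forms obtained by wedging
  theta_4 with m_14 and m_24, which vanish.\<close>

lemma godel_riemann_compatible:
  assumes "a \<noteq> 0"
  shows "riemann_compatible (godel_metric a)"
  unfolding riemann_compatible_def riem_def lower_coframe[OF coframe_curv_op[OF assms]]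
    godel_ricci_op[OF assms] linear_scale[OF linear_coframe] coframe_axis4 frame_lower_curv minor_linear
  by (simp add: minor_def axis_def algebra_simps add_divide_distrib diff_divide_distrib assms)

lemma rank_outer_product:
  fixes u v :: "real^'n"
  assumes "u \<noteq> 0" "v \<noteq> 0"
  shows "rank (\<chi> i j. u $ i * v $ j) = 1"
proof -
  have "(\<chi> i j. u $ i * v $ j) *v x = (v \<bullet> x) *\<^sub>R u" for x
    by (simp add: vec_eq_iff matrix_vector_mult_def inner_vec_def sum_distrib_left mult_ac)
  moreover have "range (\<lambda>x. (v \<bullet> x) *\<^sub>R u) = range (\<lambda>c. c *\<^sub>R u)"
  proof (intro equalityI subsetI)
    fix w assume "w \<in> range (\<lambda>c. c *\<^sub>R u)"
    then obtain c where "w = c *\<^sub>R u" by blast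
    \<comment> \<open>The multiple of \<open>v\<close> is scaled so that its inner product with
      \<open>v\<close> is \<open>c\<close>.\<close>
    then have "w = (v \<bullet> ((c / (v \<bullet> v)) *\<^sub>R v)) *\<^sub>R u" using assms(2) by simp
    then show "w \<in> range (\<lambda>x. (v \<bullet> x) *\<^sub>R u)" by blast
  qed blast
  ultimately have "rank (\<chi> i j. u $ i * v $ j) = dim (span {u})"
    by (simp add: rank_dim_range span_singleton)
  then show ?thesis using assms(1) by (simp add: dim_singleton)
qed

lemma godel_rank_ricci:
  assumes "a \<noteq> 0"
  shows "rank (\<chi> i j. ricci (godel_metric a) p (axis i 1) (axis j 1)) = 1"
proof -
  let ?u = "\<chi> i. coframe p (axis i 1) $ 4"
  have "?u $ 4 = 1" by (simp add: coframe_axis4)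
  then have "?u \<noteq> 0" by (metis zero_index zero_neq_one)
  then have "rank (\<chi> i j. ?u $ i * ?u $ j) = 1" using rank_outer_product[of ?u ?u] by blast
  then show ?thesis by (simp add: godel_ricci[OF assms])
qed

text \<open>With \<open>axis 4 1\<close> in the first slot, each tensor becomes a 2-form alpha wedge
  theta_4 in its last two arguments; wedging it with theta_4 again gives zero.\<close>

lemma frame_compatible:
  assumes "T \<in> {frame_curv, frame_weyl}"
  shows "h$4 * frame_lower T (axis 4 1) i j k + j$4 * frame_lower T (axis 4 1) i k h
    + k$4 * frame_lower T (axis 4 1) i h j = 0"
  using assms
  by (auto simp: frame_lower_curv frame_lower_weyl frame_lower_conh frame_lower_wedge minor_def axis_def
      frame_metric_def field_simps)

lemma form1_compatibleI:
  assumes "a \<noteq> 0" "T \<in> {frame_curv, frame_weyl}"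
    and T: "\<And>p. in_coframe p (D p) T"
  shows "form1_compatible (godel_metric a) (\<lambda>p. lower (godel_metric a) p (D p)) (godel_form a)"
proof -
  have form: "godel_form a p v = a * coframe p v $ 4" for p v
    by (simp add: godel_form_def coframe_nth algebra_simps)
  \<comment> \<open>The vector dual to the 1-form is \<open>axis 4 1\<close> divided by
    \<open>a\<close>, so the double sum selects \<open>s = 4\<close>.\<close>
  have key: "(\<Sum>r\<in>UNIV. \<Sum>s\<in>UNIV. godel_form a p (axis r 1) * matrix_inv (gram (godel_metric a) p) $ r $ s * F s)
     = F 4 / a" for p and F :: "4 \<Rightarrow> real"
    using assms(1) by (simp add: godel_matrix_inv[OF assms(1)] sum_4 godel_inv_def godel_form_def axis_def
        power2_eq_square exp_minus field_simps)
  have *: "a * h * (a\<^sup>2 * x) + a * j * (a\<^sup>2 * y) + a * k * (a\<^sup>2 * z) = a ^ 3 * (h * x + j * y + k * z)"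
    for h j k x y z :: real
    by (simp add: algebra_simps power2_eq_square power3_eq_cube)
  show ?thesis
    unfolding form1_compatible_def Let_def key
    unfolding lower_coframe[OF T] coframe_axis4 form *
    by (simp add: frame_compatible[OF assms(2)])
qed

section \<open>Covariant derivative of the Ricci tensor\<close>

lemma nabla_form2_ricci:
  assumes "a \<noteq> 0" "Y differentiable at p" "Z differentiable at p"
  shows "nabla_form2 (godel_metric a) (ricci (godel_metric a)) X Y Z p
    = (minor 1 2 (coframe p (X p)) (coframe p (Y p)) * coframe p (Z p) $ 4
      + minor 1 2 (coframe p (X p)) (coframe p (Z p)) * coframe p (Y p) $ 4) / 2"
proof -
  have h: "((\<lambda>q::real^4. q $ 1) has_derivative (\<lambda>v. v $ 1)) (at p)"
    by (rule bounded_linear_imp_has_derivative[OF bounded_linear_vec_nth])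
  note d = has_derivative_nth[OF has_fd[OF assms(2)]] has_derivative_nth[OF has_fd[OF assms(3)]]
  have 1: "((\<lambda>q. coframe q (Y q) $ 4 * coframe q (Z q) $ 4) has_derivative
     (\<lambda>v. (fd Y p v $ 4 + exp (p$1) * (fd Y p v $ 2 + v $ 1 * Y p $ 2)) * coframe p (Z p) $ 4
       + coframe p (Y p) $ 4 * (fd Z p v $ 4 + exp (p$1) * (fd Z p v $ 2 + v $ 1 * Z p $ 2)))) (at p)"
    unfolding coframe_nth
    by (rule h d derivative_eq_intros refl)+ (simp add: algebra_simps)
  have nabla: "nabla (godel_metric a) U V p = fd V p (U p) + gam (godel_chr p) (U p) (V p)" for U V
    by (simp add: nabla_def gam_def godel_christoffel[OF assms(1)])
  have e: "exp (p$1) * exp (- p$1) = 1" by (simp flip: exp_add)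
  \<comment> \<open>The last term is the covariant derivative of theta_4; the terms before it are
    the derivative of theta_4(V) along X, which cancel against the product rule in
    \<open>1\<close>.\<close>
  have 2: "coframe p (nabla (godel_metric a) X V p) $ 4
      = fd V p (X p) $ 4 + exp (p$1) * (fd V p (X p) $ 2 + X p $ 1 * V p $ 2)
        - minor 1 2 (coframe p (X p)) (coframe p (V p)) / 2" for V
  proof -
    have i: "exp (p$1) * (exp (- p$1) * c) = c" for c
      using arg_cong[OF e, of "\<lambda>t. t * c"] by (simp only: mult.assoc mult_1_left)
    show ?thesis
      by (simp add: i nabla coframe_nth gam_godel_chr vector_4 minor_def algebra_simps diff_divide_distrib)
  qed
  show ?thesis
    unfolding nabla_form2_def godel_ricci[OF assms(1)] fd_eqI[OF 1] 2
    by (simp add: algebra_simps add_divide_distrib)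
qed

lemma smooth_imp_differentiable: "smooth X \<Longrightarrow> X differentiable at p"
  unfolding smooth_def by (metis Ck.simps(2) UNIV_I differentiable_on_def)

lemma godel_cyclic_parallel:
  assumes "a \<noteq> 0"
  shows "cyclic_parallel (godel_metric a) (ricci (godel_metric a))"
  unfolding cyclic_parallel_def
  by (auto simp: nabla_form2_ricci[OF assms] smooth_imp_differentiable minor_def field_simps)

theorem theorem4p1:
  fixes a :: real
  assumes "a \<noteq> 0"
  defines "g \<equiv> godel_metric a"
  shows
    "cyclic_parallel g (ricci g)
     \<and> riemann_compatible g
     \<and> (\<forall>p. rank (\<chi> i j. ricci g p (axis i 1) (axis j 1)) = 1)
     \<and> (\<forall>p. act (curv_op g p) (riem g p) = tachibana (ricci g p) (riem g p))
     \<and> (\<forall>p x1 x2 x3 x4 x y. act (conh_op g p) (weyl g p) x1 x2 x3 x4 x y = 0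
                            \<and> act (conh_op g p) (conh g p) x1 x2 x3 x4 x y = 0)
     \<and> (\<forall>p x1 x2 x3 x4 x y.
          act (weyl_op g p) (weyl g p) x1 x2 x3 x4 x y = act (weyl_op g p) (conh g p) x1 x2 x3 x4 x y
        \<and> act (weyl_op g p) (conh g p) x1 x2 x3 x4 x y
            = scalar_curv g p / 6 * tachibana (g p) (weyl g p) x1 x2 x3 x4 x y)
     \<and> form1_compatible g (riem g) (godel_form a)
     \<and> form1_compatible g (weyl g) (godel_form a)"
proof -
  note C = coframe_conh_op[OF assms(1)] and W = coframe_weyl_op[OF assms(1)]
  \<comment> \<open>One a^2 comes from lowering the index, the other from the wedge operator, which
    is linear in the metric; the second cancels the 1/a^2 in kappa.\<close>
  have Q: "act (wedge (godel_metric a p)) (lower (godel_metric a) p (weyl_op (godel_metric a) p)) x1 x2 x3 x4 x y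
     = a\<^sup>2 * (a\<^sup>2 * act (wedge frame_metric) (frame_lower frame_weyl) (coframe p x1) (coframe p x2)
         (coframe p x3) (coframe p x4) (coframe p x) (coframe p y))" for p x1 x2 x3 x4 x y
    unfolding act_lower_coframe[OF coframe_wedge_metric W]
    by (simp add: act_def frame_lower_weyl frame_lower_conh frame_lower_wedge minor_linear
        frame_metric_linear algebra_simps)
  have "form1_compatible g (riem g) (godel_form a)" "form1_compatible g (weyl g) (godel_form a)"
    using form1_compatibleI[OF assms(1), of frame_curv "curv_op g"]
      form1_compatibleI[OF assms(1), of frame_weyl "weyl_op g"]
      coframe_curv_op[OF assms(1)] W
    by (simp_all add: g_def riem_def[abs_def] weyl_def[abs_def])
  moreover have "act (conh_op g p) (weyl g p) x1 x2 x3 x4 x y = 0"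
    "act (conh_op g p) (conh g p) x1 x2 x3 x4 x y = 0" for p x1 x2 x3 x4 x y
    by (simp_all add: g_def weyl_def conh_def act_lower_coframe[OF C C]
        act_lower_coframe[OF C W] act_conh_conh act_conh_weyl)
  moreover have "act (weyl_op g p) (weyl g p) x1 x2 x3 x4 x y = act (weyl_op g p) (conh g p) x1 x2 x3 x4 x y"
    "act (weyl_op g p) (conh g p) x1 x2 x3 x4 x y
       = scalar_curv g p / 6 * tachibana (g p) (weyl g p) x1 x2 x3 x4 x y" for p x1 x2 x3 x4 x y
    using assms(1)
    by (simp_all add: g_def weyl_def conh_def tachibana_def Q act_lower_coframe[OF W C]
        act_lower_coframe[OF W W] act_weyl_weyl act_weyl_conh godel_scalar_curv power2_eq_square)
  ultimately show ?thesis
    using assms(1)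
    by (simp add: g_def godel_cyclic_parallel godel_riemann_compatible godel_rank_ricci godel_act_curv)
qed

end
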